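(* Let $n\ge 1$ and let $\pi\in S_n(213)$. With $\alpha: S_n(213)\to S_n(231)$ the map defined in the context, $$\mathrm{des}(\pi)=\mathrm{des}(\alpha(\pi)),\qquad \mathrm{ides}(\pi)=\mathrm{ides}(\alpha(\pi)),\qquad \mathrm{maj}(\pi)=\mathrm{stat}(\alpha(\pi)),\qquad \mathrm{stat}(\pi)=\mathrm{maj}(\alpha(\pi)).$$
   Context: $S_n$ is the set of permutations $\pi=\pi_1\cdots\pi_n$ (one-line notation) of $[n]=\{1,\dots,n\}$. A permutation contains a pattern $\sigma\in S_k$ if some (not necessarily contiguous) subsequence of length $k$ is order isomorphic to $\sigma$; otherwise it is $\sigma$-avoiding. $S_n(\sigma)$ is the set of $\sigma$-avoiding permutations in $S_n$. Statistics on $\pi\in S_n$: the descent set is $D(\pi)=\{i\in[n-1]:\pi_i>\pi_{i+1}\}$; $\mathrm{des}(\pi)=|D(\pi)|$; $\mathrm{ides}(\pi)=\mathrm{des}(\pi^{-1})$, where $\pi^{-1}$ is the inverse permutation; $\mathrm{maj}(\pi)=\sum_{i\in D(\pi)} i$; and $\mathrm{stat}=(13\text{-}2)+(21\text{-}3)+(32\text{-}1)+(21)$, where each term counts occurrences of a generalized pattern (letters not separated by a dash must be adjacent in the permutation). Explicitly, $(21)\pi=\mathrm{des}(\pi)$, and $(13\text{-}2)\pi$, $(21\text{-}3)\pi$, $(32\text{-}1)\pi$ are the numbers of pairs $(i,j)$ with $1\le i$, $i+1<j\le n$ such that, respectively, $\pi_i<\pi_j<\pi_{i+1}$; $\pi_{i+1}<\pi_i<\pi_j$;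 $\pi_j<\pi_{i+1}<\pi_i$. The map $\phi$: let $S=\{s_1<\cdots<s_m\}$ and $T=\{t_1<\cdots<t_m\}$ be $m$-element sets of integers and let $\pi$ be a permutation of $S$ (a word using each element of $S$ once). If $m=0$, $\phi(\pi,T)$ is the empty word. Otherwise let $\pi_i=s_1$ and write $\pi=\pi'\,\pi_i\,\pi''$ ($\pi',\pi''$ possibly empty). Put $T_1=\{t_1,\dots,t_{m-i}\}$ and $T_2=\{t_{m-i+1},\dots,t_{m-1}\}$ ($T_2=\emptyset$ if $i=1$, $T_1=\emptyset$ if $i=m$). Define recursively $\phi(\pi,T)=\phi(\pi'',T_1)\,t_m\,\phi(\pi',T_2)$, a permutation of $T$. The map $\alpha$: for $\pi\in S_n(213)$ with first letter $k$, one can write $\pi=k\,\pi'\,\pi''$ with $\pi'$ a permutation of $\{k+1,\dots,n\}$ and $\pi''$ a permutation of $[k-1]=\{1,\dots,k-1\}$ (either may be empty). Define $$\alpha(\pi)=k\,\phi(\pi'',[k-1])\,\phi(\pi',\{k+1,\dots,n\}).$$ *)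

theory Defs
  imports "HOL-Combinatorics.Multiset_Permutations" "HOL-Library.Sublist"
begin

text \<open>
  A permutation of a finite set is a word (list) using every element of the set exactly once.
  Words are lists, so list positions start at 0; \<open>letter w i\<close> is the \<open>i\<close>-th letter
  counted from 1, and all positions \<open>i\<close>, \<open>j\<close> in the statistics below are 1-based.
\<close>

definition letter :: "'a list \<Rightarrow> nat \<Rightarrow> 'a" where
  "letter w i = w ! (i - 1)"

definition Sn :: "nat \<Rightarrow> nat list set" where
  "Sn n = permutations_of_set {1..n}"

definition order_isomorphic :: "'a::linorder list \<Rightarrow> 'b::linorder list \<Rightarrow> bool" where
  "order_isomorphic u v \<longleftrightarrow> length u = length v \<and>
     (\<forall>i<length u. \<forall>j<length u. u ! i < u ! j \<longleftrightarrow> v ! i < v ! j)"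

definition contains_pattern :: "'a::linorder list \<Rightarrow> nat list \<Rightarrow> bool" where
  "contains_pattern w \<sigma> \<longleftrightarrow> (\<exists>u. subseq u w \<and> order_isomorphic u \<sigma>)"

definition Sn_avoiding :: "nat \<Rightarrow> nat list \<Rightarrow> nat list set" where
  "Sn_avoiding n \<sigma> = {\<pi> \<in> Sn n. \<not> contains_pattern \<pi> \<sigma>}"

definition descent_set :: "nat list \<Rightarrow> nat set" where
  "descent_set \<pi> = {i \<in> {1..<length \<pi>}. letter \<pi> i > letter \<pi> (i + 1)}"

definition des :: "nat list \<Rightarrow> nat" where
  "des \<pi> = card (descent_set \<pi>)"

definition maj :: "nat list \<Rightarrow> nat" where
  "maj \<pi> = \<Sum>(descent_set \<pi>)"

definition inverse_perm :: "nat list \<Rightarrow> nat list" where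
  "inverse_perm \<pi> = map (inv_into {1..length \<pi>} (letter \<pi>)) [1..<length \<pi> + 1]"

definition ides :: "nat list \<Rightarrow> nat" where
  "ides \<pi> = des (inverse_perm \<pi>)"

definition occ_13_2 :: "nat list \<Rightarrow> nat" where
  "occ_13_2 \<pi> = card {(i, j). 1 \<le> i \<and> i + 1 < j \<and> j \<le> length \<pi> \<and>
     letter \<pi> i < letter \<pi> j \<and> letter \<pi> j < letter \<pi> (i + 1)}"

definition occ_21_3 :: "nat list \<Rightarrow> nat" where
  "occ_21_3 \<pi> = card {(i, j). 1 \<le> i \<and> i + 1 < j \<and> j \<le> length \<pi> \<and>
     letter \<pi> (i + 1) < letter \<pi> i \<and> letter \<pi> i < letter \<pi> j}"

definition occ_32_1 :: "nat list \<Rightarrow> nat" where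
  "occ_32_1 \<pi> = card {(i, j). 1 \<le> i \<and> i + 1 < j \<and> j \<le> length \<pi> \<and>
     letter \<pi> j < letter \<pi> (i + 1) \<and> letter \<pi> (i + 1) < letter \<pi> i}"

text \<open>The last summand of \<open>stat\<close> is the pattern (21), whose occurrences are the descents.\<close>

definition stat :: "nat list \<Rightarrow> nat" where
  "stat \<pi> = occ_13_2 \<pi> + occ_21_3 \<pi> + occ_32_1 \<pi> + des \<pi>"

text \<open>
  In the equation for \<open>phi\<close>, \<open>m\<close> is the length of the word, \<open>i\<close> the 1-based position of its
  least letter, and \<open>u\<close>, \<open>v\<close> are the parts of the word before and after that letter.
  The target set \<open>T = {t\<^sub>1 < \<dots> < t\<^sub>m}\<close> is meant to have \<open>m\<close> elements;
  \<open>t\<^sub>j\<close> is \<open>letter ts j\<close>.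
\<close>

function phi :: "'a::linorder list \<Rightarrow> 'b::linorder set \<Rightarrow> 'b list" where
  "phi [] T = []"
| "phi (x # xs) T =
     (let w = x # xs;
          m = length w;
          ts = sorted_list_of_set T;
          s\<^sub>1 = Min (set w);
          u = takeWhile (\<lambda>y. y \<noteq> s\<^sub>1) w;
          v = tl (dropWhile (\<lambda>y. y \<noteq> s\<^sub>1) w);
          i = length u + 1;
          T\<^sub>1 = letter ts ` {1..m - i};
          T\<^sub>2 = letter ts ` {m - i + 1..m - 1}
      in phi v T\<^sub>1 @ letter ts m # phi u T\<^sub>2)"
  by pat_completeness auto

lemma takeWhile_Min_decomp:
  assumes "w \<noteq> []"
  shows "w = takeWhile (\<lambda>y. y \<noteq> Min (set w)) w @ Min (set w) #
    tl (dropWhile (\<lambda>y. y \<noteq> Min (set w)) w)"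
proof -
  have ne: "dropWhile (\<lambda>y. y \<noteq> Min (set w)) w \<noteq> []"
    using assms by (simp add: dropWhile_eq_Nil_conv)
  then have "hd (dropWhile (\<lambda>y. y \<noteq> Min (set w)) w) = Min (set w)"
    using hd_dropWhile by blast
  then show ?thesis
    by (metis ne list.collapse takeWhile_dropWhile_id)
qed

lemma length_Min_parts:
  assumes "w \<noteq> []"
  shows "length (takeWhile (\<lambda>y. y \<noteq> Min (set w)) w) < length w"
    and "length (tl (dropWhile (\<lambda>y. y \<noteq> Min (set w)) w)) < length w"
proof -
  have "length w = length (takeWhile (\<lambda>y. y \<noteq> Min (set w)) w) +
      Suc (length (tl (dropWhile (\<lambda>y. y \<noteq> Min (set w)) w)))"
    using arg_cong[OF takeWhile_Min_decomp[OF assms], of length]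
    by (simp only: length_append list.size)
  then show "length (takeWhile (\<lambda>y. y \<noteq> Min (set w)) w) < length w"
    and "length (tl (dropWhile (\<lambda>y. y \<noteq> Min (set w)) w)) < length w"
    by linarith+
qed

termination phi
  by (relation "measure (\<lambda>(w, T). length w)")
     (simp_all only: in_measure wf_measure prod.case length_Min_parts list.distinct not_False_eq_True)

text \<open>
  For \<open>k # w\<close> in \<open>Sn_avoiding n [2, 1, 3]\<close> the first \<open>n - k\<close> letters of \<open>w\<close> are those greater than
  \<open>k\<close> and the remaining ones are those less than \<open>k\<close>; this is lemma \<open>avoiding_213_decomp\<close> below.
\<close>

fun alpha :: "nat list \<Rightarrow> nat list" where
  "alpha [] = []"
| "alpha (k # w) =
     (let n = length (k # w)
      in k # phi (drop (n - k) w) {1..k - 1} @ phi (take (n - k) w) {k + 1..n})"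

lemma all_less_3: "(\<forall>i<3. P i) \<longleftrightarrow> P 0 \<and> P 1 \<and> P (2::nat)"
  by (auto simp: numeral_3_eq_3 numeral_2_eq_2 less_Suc_eq)

lemma order_isomorphic_213:
  "order_isomorphic u [2, 1, 3::nat] \<longleftrightarrow> (\<exists>a b c. u = [a, b, c] \<and> b < a \<and> a < c)"
proof -
  have "order_isomorphic [a, b, c] [2, 1, 3::nat] \<longleftrightarrow> b < a \<and> a < c" for a b c :: 'a
    by (auto simp: order_isomorphic_def all_less_3 simp flip: numeral_3_eq_3)
  moreover have "\<exists>a b c. u = [a, b, c]" if "order_isomorphic u [2, 1, 3::nat]"
    using that by (auto simp: order_isomorphic_def length_Suc_conv)
  ultimately show ?thesis by blast
qed

lemma order_isomorphic_231:
  "order_isomorphic u [2, 3, 1::nat] \<longleftrightarrow> (\<exists>a b c. u = [a, b, c] \<and> c < a \<and> a < b)"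
proof -
  have "order_isomorphic [a, b, c] [2, 3, 1::nat] \<longleftrightarrow> c < a \<and> a < b" for a b c :: 'a
    by (auto simp: order_isomorphic_def all_less_3 simp flip: numeral_3_eq_3)
  moreover have "\<exists>a b c. u = [a, b, c]" if "order_isomorphic u [2, 3, 1::nat]"
    using that by (auto simp: order_isomorphic_def length_Suc_conv)
  ultimately show ?thesis by blast
qed

lemma contains_213_iff:
  "contains_pattern w [2, 1, 3] \<longleftrightarrow> (\<exists>a b c. subseq [a, b, c] w \<and> b < a \<and> a < c)"
  unfolding contains_pattern_def order_isomorphic_213 by blast

lemma contains_231_iff:
  "contains_pattern w [2, 3, 1] \<longleftrightarrow> (\<exists>a b c. subseq [a, b, c] w \<and> c < a \<and> a < b)"
  unfolding contains_pattern_def order_isomorphic_231 by blast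

lemma subseq_triple_append:
  "subseq [a, b, c] (u @ v) \<longleftrightarrow> subseq [a, b, c] u \<or> (subseq [a, b] u \<and> c \<in> set v) \<or>
     (a \<in> set u \<and> subseq [b, c] v) \<or> subseq [a, b, c] v"
  (is "_ \<longleftrightarrow> ?R")
proof
  show "subseq [a, b, c] (u @ v) \<Longrightarrow> ?R"
    unfolding subseq_append_iff append_eq_Cons_conv Cons_eq_append_conv
    by (auto simp: subseq_singleton_left)
  have "subseq ([a, b] @ [c]) (u @ v)" if "subseq [a, b] u" "c \<in> set v"
    using that by (intro list_emb_append_mono) (simp_all add: subseq_singleton_left)
  moreover have "subseq ([a] @ [b, c]) (u @ v)" if "a \<in> set u" "subseq [b, c] v"
    using that by (intro list_emb_append_mono) (simp_all add: subseq_singleton_left)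
  ultimately show "?R \<Longrightarrow> subseq [a, b, c] (u @ v)"
    by (auto intro: list_emb_append2 subseq_order.trans[OF _ list_emb_append2])
qed

lemma subseq_pair_set: "subseq [a, b] u \<Longrightarrow> a \<in> set u \<and> b \<in> set u"
  by (metis list.set_intros subseq_order.trans subseq_singleton_left list_emb_set)

lemma avoids_231_append:
  assumes "\<not> contains_pattern u [2, 3, 1]" "\<not> contains_pattern v [2, 3, 1]"
    and "\<And>a b. a \<in> set u \<Longrightarrow> b \<in> set v \<Longrightarrow> a < b"
  shows "\<not> contains_pattern (u @ v) [2, 3, 1]"
  using assms unfolding contains_231_iff subseq_triple_append
  by (meson subseq_pair_set less_asym)

lemma avoids_231_Cons:
  assumes "\<not> contains_pattern v [2, 3, 1]" and "\<And>b. b \<in> set v \<Longrightarrow> b < a"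
  shows "\<not> contains_pattern (a # v) [2, 3, 1]"
  using assms unfolding contains_231_iff
  by (auto split: if_splits dest: subseq_pair_set) (meson subseq_pair_set less_asym)+

lemma phi_word:
  assumes "finite T" "card T = length w"
  shows "set (phi w T) = T \<and> length (phi w T) = length w \<and> \<not> contains_pattern (phi w T) [2, 3, 1]"
  using assms
proof (induction w T rule: phi.induct)
  case (1 T)
  then show ?case by (simp add: contains_231_iff del: One_nat_def)
next
  case (2 x xs T)
  define w where "w = x # xs"
  define m where "m = length w"
  define ts where "ts = sorted_list_of_set T"
  define u where "u = takeWhile (\<lambda>y. y \<noteq> Min (set w)) w"
  define v where "v = tl (dropWhile (\<lambda>y. y \<noteq> Min (set w)) w)"
  define i where "i = length u + 1"
  define T1 where "T1 = letter ts ` {1..m - i}"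
  define T2 where "T2 = letter ts ` {m - i + 1..m - 1}"
  have w: "w = u @ Min (set w) # v"
    unfolding u_def v_def by (rule takeWhile_Min_decomp) (simp add: w_def)
  have m: "m = length u + length v + 1"
    unfolding m_def by (subst w) simp
  have ts: "length ts = m" "set ts = T" "sorted_wrt (<) ts"
    using "2.prems" by (simp_all add: ts_def m_def w_def)
  have mono: "letter ts j < letter ts k" if "1 \<le> j" "j < k" "k \<le> m" for j k
    using that ts sorted_wrt_nth_less[OF ts(3), of "j - 1" "k - 1"] by (simp add: letter_def)
  have inj: "inj_on (letter ts) {1..m}"
    by (rule linorder_inj_onI) (use mono in \<open>fastforce+\<close>)
  have T: "T = letter ts ` {1..m}"
  proof -
    have "T = (!) ts ` {0..<m}"
      unfolding ts(2)[symmetric] ts(1)[symmetric] by (auto simp: set_conv_nth)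
    also have "{0..<m} = (\<lambda>j. j - 1) ` {1..m}"
      by (auto simp: image_iff intro!: bexI[of _ "Suc _"])
    finally show ?thesis by (simp add: image_image letter_def)
  qed
  have c1: "finite T1" "card T1 = length v"
    unfolding T1_def using m by (auto simp: i_def card_image inj_on_subset[OF inj])
  have c2: "finite T2" "card T2 = length u"
    unfolding T2_def using m by (auto simp: i_def card_image inj_on_subset[OF inj])
  have IH1: "set (phi v T1) = T1 \<and> length (phi v T1) = length v \<and>
      \<not> contains_pattern (phi v T1) [2, 3, 1]"
    by (rule "2.IH"(1)[OF w_def m_def ts_def refl u_def v_def i_def T1_def T2_def c1])
  have IH2: "set (phi u T2) = T2 \<and> length (phi u T2) = length u \<and>
      \<not> contains_pattern (phi u T2) [2, 3, 1]"
    by (rule "2.IH"(2)[OF w_def m_def ts_def refl u_def v_def i_def T1_def T2_def c2])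
  have eq: "phi (x # xs) T = phi v T1 @ letter ts m # phi u T2"
    by (simp only: phi.simps Let_def w_def m_def ts_def u_def v_def i_def T1_def T2_def)
  have "{1..m} = insert m ({1..m - i} \<union> {m - i + 1..m - 1})"
    using m by (auto simp: i_def)
  then have "T = insert (letter ts m) (T1 \<union> T2)"
    unfolding T T1_def T2_def by (metis image_insert image_Un)
  moreover have "\<not> contains_pattern (phi v T1 @ letter ts m # phi u T2) [2, 3, 1]"
  proof (intro avoids_231_append avoids_231_Cons)
    show "b < letter ts m" if "b \<in> set (phi u T2)" for b
      using that IH2 m by (auto simp: T2_def i_def intro!: mono)
    show "a < b" if "a \<in> set (phi v T1)" "b \<in> set (letter ts m # phi u T2)" for a b
      using that IH1 IH2 m by (auto simp: T1_def T2_def i_def intro!: mono)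
  qed (use IH1 IH2 in auto)
  moreover have "length (phi v T1 @ letter ts m # phi u T2) = length (x # xs)"
    using IH1 IH2 m unfolding m_def w_def by simp
  ultimately show ?case
    unfolding eq using IH1 IH2 by (simp add: Un_commute)
qed

lemma avoiding_213_decomp:
  assumes "k # w \<in> Sn_avoiding n [2, 1, 3]"
  shows "length (k # w) = n" "1 \<le> k" "k \<le> n"
    and "take (n - k) w \<in> permutations_of_set {k + 1..n}"
    and "drop (n - k) w \<in> permutations_of_set {1..k - 1}"
proof -
  from assms have set: "set (k # w) = {1..n}" and dist: "distinct (k # w)"
    and av: "\<not> contains_pattern (k # w) [2, 1, 3]"
    by (auto simp: Sn_avoiding_def Sn_def permutations_of_set_def)
  show len: "length (k # w) = n"
    using distinct_card[OF dist] set by simp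
  show k: "1 \<le> k" "k \<le> n"
    using set by auto
  have no: False if "subseq [b, c] w" "b < k" "k < c" for b c
    using av that unfolding contains_213_iff by (metis subseq_Cons2)
  define p where "p = takeWhile (\<lambda>y. k < y) w"
  define q where "q = dropWhile (\<lambda>y. k < y) w"
  have pq: "w = p @ q"
    by (simp add: p_def q_def)
  have p: "k < y" if "y \<in> set p" for y
    using that unfolding p_def by (rule set_takeWhileD[THEN conjunct2])
  have q: "y < k" if "y \<in> set q" for y
  proof (cases q)
    case (Cons z zs)
    have "\<not> k < z"
      using hd_dropWhile[of "\<lambda>y. k < y" w] Cons unfolding q_def by fastforce
    moreover have "z \<noteq> k" "y \<noteq> k"
      using dist pq Cons that by auto
    moreover have "subseq [z, y] w" if "y \<noteq> z"
      using that \<open>y \<in> set q\<close> pq Cons by (auto simp: subseq_singleton_left intro: list_emb_append2)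
    ultimately show ?thesis
      using no[of z y] by (metis linorder_neqE_nat)
  qed (use that in simp)
  have un: "set p \<union> set q = {1..n} - {k}"
    using set dist pq by auto
  have "y \<in> set p \<longleftrightarrow> k + 1 \<le> y \<and> y \<le> n" for y
  proof -
    have "y \<in> set p \<or> y \<in> set q \<longleftrightarrow> 1 \<le> y \<and> y \<le> n \<and> y \<noteq> k"
      using un by (auto simp: set_eq_iff)
    then show ?thesis using p[of y] q[of y] k by linarith
  qed
  moreover have "y \<in> set q \<longleftrightarrow> 1 \<le> y \<and> y \<le> k - 1" for y
  proof -
    have "y \<in> set p \<or> y \<in> set q \<longleftrightarrow> 1 \<le> y \<and> y \<le> n \<and> y \<noteq> k"
      using un by (auto simp: set_eq_iff)
    then show ?thesis using p[of y] q[of y] k by linarith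
  qed
  ultimately have sets: "set p = {k + 1..n}" "set q = {1..k - 1}"
    by (simp_all add: set_eq_iff)
  have "length p = n - k"
    using distinct_card[of p] dist pq sets by simp
  then have "take (n - k) w = p" "drop (n - k) w = q"
    using pq by auto
  then show "take (n - k) w \<in> permutations_of_set {k + 1..n}"
    and "drop (n - k) w \<in> permutations_of_set {1..k - 1}"
    using sets dist pq by (auto simp: permutations_of_set_def)
qed

lemma alpha_in_Sn_avoiding_231:
  assumes "1 \<le> n" "\<pi> \<in> Sn_avoiding n [2, 1, 3]"
  shows "alpha \<pi> \<in> Sn_avoiding n [2, 3, 1]"
proof -
  obtain k w where \<pi>: "\<pi> = k # w"
    using assms by (cases \<pi>) (auto simp: Sn_avoiding_def Sn_def permutations_of_set_def)
  note d = avoiding_213_decomp[OF assms(2)[unfolded \<pi>]]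
  have l: "length (drop (n - k) w) = k - 1" "length (take (n - k) w) = n - k"
    using d(1-3) by auto
  let ?A = "phi (drop (n - k) w) {1..k - 1}" and ?B = "phi (take (n - k) w) {k + 1..n}"
  have A: "set ?A = {1..k - 1}" "length ?A = k - 1" "\<not> contains_pattern ?A [2, 3, 1]"
    using phi_word[of "{1..k - 1}" "drop (n - k) w"] l by auto
  have B: "set ?B = {k + 1..n}" "length ?B = n - k" "\<not> contains_pattern ?B [2, 3, 1]"
    using phi_word[of "{k + 1..n}" "take (n - k) w"] l by auto
  have eq: "alpha \<pi> = k # ?A @ ?B"
    using d(1) by (simp add: \<pi> Let_def)
  have s: "set (alpha \<pi>) = {1..n}"
    unfolding eq using A(1) B(1) d(2,3) by auto
  have "length (alpha \<pi>) = n"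
    unfolding eq using A(2) B(2) d(2,3) by simp
  then have "distinct (alpha \<pi>)"
    using s by (intro card_distinct) simp
  moreover have "\<not> contains_pattern ((k # ?A) @ ?B) [2, 3, 1]"
    using A B d(2) by (intro avoids_231_append avoids_231_Cons) auto
  ultimately show ?thesis
    using s eq by (simp add: Sn_avoiding_def Sn_def permutations_of_set_def)
qed

end

theory Submission
  imports Defs
begin

text \<open>
  In a word avoiding 213 everything before the least letter \<open>s\<close> exceeds everything after it, so the
  word \<open>u @ s # v\<close> is the skew sum of \<open>u\<close> and \<open>s # v\<close>, and \<open>phi\<close> turns it into the direct sum of the
  image of \<open>v\<close> and the skew sum of the new greatest letter and the image of \<open>u\<close>.
  Write \<open>occ = stat - des\<close> and let \<open>below_hd w\<close> be the number of letters of \<open>w\<close> less than its first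
  one. All statistics are computed on direct and skew sums, where \<open>occ\<close> of \<open>u @ v\<close> has the same
  expression in both cases. By induction, \<open>phi\<close> preserves \<open>des\<close> and the number of inverse
  descents and exchanges \<open>maj\<close> with \<open>occ + below_hd\<close>. Putting the first letter \<open>k\<close> in front of two
  such blocks replaces the \<open>below_hd\<close> terms by occurrences of patterns at the block boundaries.
\<close>

section \<open>Descents and \<open>maj\<close> of a word with a letter prepended\<close>

lemma letter_Cons_Suc: "1 \<le> i \<Longrightarrow> letter (x # w) (Suc i) = letter w i"
  by (cases i) (auto simp: letter_def)

lemma letter_1 [simp]: "letter (x # w) (Suc 0) = x"
  by (simp add: letter_def)

lemma finite_descent_set: "finite (descent_set w)"
  by (simp add: descent_set_def)

lemma descent_set_Cons_Cons:
  "descent_set (x # y # w) = (if y < x then {1} else {}) \<union> Suc ` descent_set (y # w)"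
proof (rule set_eqI)
  fix i
  consider "i = 0" | "i = 1" | j where "i = Suc j" "1 \<le> j"
    by (cases i) force+
  then show "i \<in> descent_set (x # y # w) \<longleftrightarrow>
      i \<in> (if y < x then {1} else {}) \<union> Suc ` descent_set (y # w)"
  proof cases
    case 3
    then show ?thesis
      by (auto simp: descent_set_def letter_Cons_Suc inj_image_mem_iff)
  qed (auto simp: descent_set_def letter_def)
qed

lemma des_Nil [simp]: "des [] = 0" and des_singleton [simp]: "des [x] = 0"
  and maj_Nil [simp]: "maj [] = 0" and maj_singleton [simp]: "maj [x] = 0"
  by (simp_all add: des_def maj_def descent_set_def)

lemma notin_Suc_descent_set: "Suc 0 \<notin> Suc ` descent_set w"
  by (auto simp: descent_set_def)

lemma des_Cons_Cons [simp]: "des (x # y # w) = of_bool (y < x) + des (y # w)"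
  by (simp add: des_def descent_set_Cons_Cons card_image finite_descent_set notin_Suc_descent_set)

text \<open>Prepending a letter moves every old descent one position to the right, so
  \<open>maj\<close> grows by the number of old descents. A new descent at the front sits at
  position 1 and contributes 1.\<close>

lemma maj_Cons_Cons [simp]:
  "maj (x # y # w) = of_bool (y < x) + des (y # w) + maj (y # w)"
proof -
  have "\<Sum>(Suc ` descent_set (y # w)) = des (y # w) + maj (y # w)"
    by (simp add: sum.reindex des_def maj_def sum_Suc)
  then show ?thesis
    by (simp add: maj_def descent_set_Cons_Cons finite_descent_set notin_Suc_descent_set)
qed

section \<open>Occurrences of generalized patterns\<close>

text \<open>The common shape of the three patterns in \<open>stat\<close>: \<open>P\<close> receives
  the two adjacent letters and then the distant one, so one recursion serves all three.\<close>

definition vincular_occs :: "(nat \<Rightarrow> nat \<Rightarrow> nat \<Rightarrow> bool) \<Rightarrow> nat list \<Rightarrow> (nat \<times> nat) set" where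
  "vincular_occs P w = {(i, j). 1 \<le> i \<and> i + 1 < j \<and> j \<le> length w \<and>
     P (letter w i) (letter w (i + 1)) (letter w j)}"

lemma finite_vincular_occs: "finite (vincular_occs P w)"
  by (rule finite_subset[of _ "{..length w} \<times> {..length w}"]) (auto simp: vincular_occs_def)

text \<open>An occurrence starting at position 1 uses \<open>x\<close>, \<open>y\<close> and some
  letter of \<open>w\<close>. The index \<open>j\<close> into \<open>w\<close> counts from 0, whence
  the position \<open>j + 3\<close>. All other occurrences avoid \<open>x\<close> and are shifted by
  one in both coordinates.\<close>

lemma vincular_occs_Cons_Cons:
  "vincular_occs P (x # y # w) =
     (\<lambda>j. (1, j + 3)) ` {j. j < length w \<and> P x y (w ! j)} \<union>
     map_prod Suc Suc ` vincular_occs P (y # w)"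
proof (rule set_eqI, clarify)
  fix i j
  consider "i = 0" | "i = 1" | k where "i = Suc k" "1 \<le> k"
    by (cases i) force+
  then show "(i, j) \<in> vincular_occs P (x # y # w) \<longleftrightarrow>
      (i, j) \<in> (\<lambda>j. (1, j + 3)) ` {j. j < length w \<and> P x y (w ! j)} \<union>
        map_prod Suc Suc ` vincular_occs P (y # w)"
  proof cases
    case 2
    have "j = (j - 3) + 3" if "2 < j"
      using that by simp
    then show ?thesis
      using 2 by (auto simp: vincular_occs_def letter_def image_iff numeral_3_eq_3 numeral_2_eq_2
          intro!: exI[of _ "j - 3"] dest!: less_imp_Suc_add)
  next
    case 3
    show ?thesis
    proof (cases j)
      case (Suc l)
      have "(i, j) \<in> map_prod Suc Suc ` vincular_occs P (y # w) \<longleftrightarrow> (k, l) \<in> vincular_occs P (y # w)"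
        using 3 Suc by force
      then show ?thesis
        using 3 Suc by (auto simp: vincular_occs_def letter_Cons_Suc)
    qed (auto simp: vincular_occs_def)
  qed (auto simp: vincular_occs_def)
qed

lemma card_vincular_occs_Nil [simp]: "card (vincular_occs P []) = 0"
  and card_vincular_occs_singleton [simp]: "card (vincular_occs P [x]) = 0"
  by (auto simp: vincular_occs_def card_eq_0_iff)

lemma card_vincular_occs_Cons_Cons [simp]:
  "card (vincular_occs P (x # y # w)) =
     length (filter (P x y) w) + card (vincular_occs P (y # w))"
proof -
  have "inj_on (map_prod Suc Suc) (vincular_occs P (y # w))"
    "inj_on (\<lambda>j. (1 :: nat, j + 3)) {j. j < length w \<and> P x y (w ! j)}"
    by (auto simp: inj_on_def)
  moreover have "(\<lambda>j. (1, j + 3)) ` {j. j < length w \<and> P x y (w ! j)} \<inter>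
      map_prod Suc Suc ` vincular_occs P (y # w) = {}"
    by (auto simp: vincular_occs_def)
  ultimately show ?thesis
    unfolding vincular_occs_Cons_Cons
    by (simp add: card_Un_disjoint finite_vincular_occs card_image length_filter_conv_card)
qed

definition occ :: "nat list \<Rightarrow> nat" where
  "occ w = occ_13_2 w + occ_21_3 w + occ_32_1 w"

lemma occ_conv_vincular:
  "occ w = card (vincular_occs (\<lambda>a b c. a < c \<and> c < b) w) +
     card (vincular_occs (\<lambda>a b c. b < a \<and> a < c) w) +
     card (vincular_occs (\<lambda>a b c. c < b \<and> b < a) w)"
  by (simp add: occ_def occ_13_2_def occ_21_3_def occ_32_1_def vincular_occs_def)

lemma stat_conv_occ: "stat w = occ w + des w"
  by (simp add: stat_def occ_def)

lemma occ_Nil [simp]: "occ [] = 0" and occ_singleton [simp]: "occ [x] = 0"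
  by (simp_all add: occ_conv_vincular)

lemma occ_Cons_Cons [simp]:
  "occ (x # y # w) = length (filter (\<lambda>z. x < z \<and> z < y) w) +
     length (filter (\<lambda>z. y < x \<and> x < z) w) + length (filter (\<lambda>z. z < y \<and> y < x) w) +
     occ (y # w)"
  by (simp add: occ_conv_vincular)

text \<open>The statistic that has to be added to \<open>occ\<close> to make \<open>phi\<close> exchange it with \<open>maj\<close>.\<close>

fun below_hd :: "nat list \<Rightarrow> nat" where
  "below_hd [] = 0"
| "below_hd (x # w) = length (filter (\<lambda>z. z < x) w)"

text \<open>\<open>direct u v\<close> and \<open>direct v u\<close> say that \<open>u @ v\<close> is a direct sum, respectively a skew sum.\<close>

definition direct :: "nat list \<Rightarrow> nat list \<Rightarrow> bool" where
  "direct u v \<longleftrightarrow> (\<forall>x\<in>set u. \<forall>y\<in>set v. x < y)"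

lemma direct_simps [simp]:
  "direct [] v" "direct u []"
  "direct (x # u) v \<longleftrightarrow> (\<forall>y\<in>set v. x < y) \<and> direct u v"
  "direct u (y # v) \<longleftrightarrow> (\<forall>x\<in>set u. x < y) \<and> direct u v"
  "direct (u @ u') v \<longleftrightarrow> direct u v \<and> direct u' v"
  "direct u (v @ v') \<longleftrightarrow> direct u v \<and> direct u v'"
  by (auto simp: direct_def)

section \<open>Descents, \<open>maj\<close>, \<open>occ\<close> and \<open>below_hd\<close> of
  direct and skew sums\<close>

text \<open>The pair at the boundary ascends and adds no descent. Peeling letters off
  \<open>u\<close> until one is left makes this pair the first two letters of the word.\<close>

lemma des_direct_sum: "direct u v \<Longrightarrow> des (u @ v) = des u + des v"
  by (induction u rule: induct_list012; cases v) auto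

lemma des_skew_sum: "direct v u \<Longrightarrow> des (u @ v) = des u + des v + of_bool (u \<noteq> [] \<and> v \<noteq> [])"
  by (induction u rule: induct_list012; cases v) auto

lemma maj_direct_sum: "direct u v \<Longrightarrow> maj (u @ v) = maj u + maj v + length u * des v"
proof (induction u rule: induct_list012)
  case (3 x y u)
  then show ?case
    using des_direct_sum[of "y # u" v] by auto
qed (cases v; auto)+

text \<open>The descents of \<open>v\<close> shift by \<open>length u\<close>, and the boundary is a
  new descent at position \<open>length u\<close>. For empty \<open>u\<close> this position is 0, so
  only \<open>v\<close> needs a case distinction.\<close>

lemma maj_skew_sum:
  "direct v u \<Longrightarrow> maj (u @ v) = maj u + maj v + length u * des v + (if v = [] then 0 else length u)"
proof (induction u rule: induct_list012)
  case (3 x y u)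
  then show ?case
    using des_skew_sum[of v "y # u"] by auto
qed (cases v; auto)+

lemma length_filter_const:
  "\<forall>z\<in>set v. P z = c \<Longrightarrow> length (filter P v) = (if c then length v else 0)"
  by (cases c) auto

text \<open>A descent inside \<open>u\<close> forms a 21-3 with every letter of \<open>v\<close>.
  The pair across the boundary forms a 13-2 with exactly those letters of \<open>v\<close> that are
  less than its first letter.\<close>

lemma occ_direct_sum:
  "direct u v \<Longrightarrow> occ (u @ v) = occ u + occ v + of_bool (u \<noteq> []) * below_hd v + des u * length v"
proof (induction u rule: induct_list012)
  case (2 x)
  then show ?case
  proof (cases v)
    case (Cons y v')
    then have "filter (\<lambda>z. x < z \<and> z < y) v' = filter (\<lambda>z. z < y) v'"
      using 2 by (intro filter_cong) auto
    then show ?thesis using 2 Cons by auto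
  qed simp
next
  case (3 x y u)
  \<comment> \<open>Every letter of \<open>v\<close> exceeds both \<open>x\<close> and
    \<open>y\<close>, so each of the three conditions has a single truth value on all of
    \<open>v\<close>.\<close>
  have "length (filter (\<lambda>z. x < z \<and> z < y) v) = (if False then length v else 0)"
    "length (filter (\<lambda>z. y < x \<and> x < z) v) = (if y < x then length v else 0)"
    "length (filter (\<lambda>z. z < y \<and> y < x) v) = (if False then length v else 0)"
    by (rule length_filter_const; use 3(3) in auto)+
  then show ?case
    using 3 by auto
qed simp

text \<open>The counts agree with those of the direct sum, but now both come from 32-1: a descent
  inside \<open>u\<close> combines with every letter of \<open>v\<close>, and the descent across the
  boundary with the letters below the first one of \<open>v\<close>.\<close>

lemma occ_skew_sum:
  "direct v u \<Longrightarrow> occ (u @ v) = occ u + occ v + of_bool (u \<noteq> []) * below_hd v + des u * length v"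
proof (induction u rule: induct_list012)
  case (2 x)
  then show ?case
    by (cases v) (auto simp: filter_empty_conv dest: less_asym)
next
  case (3 x y u)
  have "length (filter (\<lambda>z. x < z \<and> z < y) v) = (if False then length v else 0)"
    "length (filter (\<lambda>z. y < x \<and> x < z) v) = (if False then length v else 0)"
    "length (filter (\<lambda>z. z < y \<and> y < x) v) = (if y < x then length v else 0)"
    by (rule length_filter_const; use 3(3) in auto)+
  then show ?case
    using 3 by auto
qed simp

lemma below_hd_direct_sum:
  "direct u v \<Longrightarrow> below_hd (u @ v) = (if u = [] then below_hd v else below_hd u)"
  by (cases u) (auto simp: filter_empty_conv intro: less_asym)

lemma below_hd_skew_sum:
  "direct v u \<Longrightarrow> below_hd (u @ v) = (if u = [] then below_hd v else below_hd u + length v)"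
  by (cases u) (auto simp: direct_def intro!: filter_True arg_cong[where f = length])

section \<open>Inverse descents\<close>

text \<open>A form of inverse descents that makes sense over any set of letters, as is needed for
  the subwords in the recursion of \<open>phi\<close>: \<open>y\<close> stands before
  \<open>x\<close> and no letter lies strictly between them in value.\<close>

definition inverse_descents :: "nat list \<Rightarrow> (nat \<times> nat) set" where
  "inverse_descents w =
     {(y, x). x < y \<and> subseq [y, x] w \<and> (\<forall>z\<in>set w. z \<le> x \<or> y \<le> z)}"

lemma finite_inverse_descents: "finite (inverse_descents w)"
  by (rule finite_subset[of _ "set w \<times> set w"])
     (auto simp: inverse_descents_def dest: subseq_pair_set)

lemma subseq_pair_append:
  "subseq [a, b] (u @ v) \<longleftrightarrow> subseq [a, b] u \<or> a \<in> set u \<and> b \<in> set v \<or> subseq [a, b] v"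
  by (induction u) (auto simp: subseq_singleton_left dest: subseq_pair_set)

lemma card_inverse_descents_Nil [simp]: "card (inverse_descents []) = 0"
  and card_inverse_descents_singleton [simp]: "card (inverse_descents [x]) = 0"
  by (auto simp: inverse_descents_def card_eq_0_iff split: if_splits)

lemma inverse_descents_disjoint:
  assumes "set u \<inter> set v = {}"
  shows "inverse_descents u \<inter> inverse_descents v = {}"
  using assms by (auto simp: inverse_descents_def dest!: subseq_pair_set)

text \<open>Once the order of appearance is known in both words, only the gap condition depends on
  the remaining letters, and letters outside the gap do not affect it.\<close>

lemma mem_inverse_descents_cong:
  assumes "subseq [y, x] w'" "subseq [y, x] w" "set w \<subseteq> set w'"
    and "\<forall>z\<in>set w' - set w. z \<le> x \<or> y \<le> z"
  shows "(y, x) \<in> inverse_descents w' \<longleftrightarrow> (y, x) \<in> inverse_descents w"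
  using assms by (auto simp: inverse_descents_def)

text \<open>A pair with its first letter in \<open>u\<close> and its second in \<open>v\<close>
  increases, so no inverse descent crosses the boundary. Neither summand has letters inside a gap of
  the other.\<close>

lemma card_inverse_descents_direct_sum:
  assumes "direct u v"
  shows "card (inverse_descents (u @ v)) = card (inverse_descents u) + card (inverse_descents v)"
proof -
  have less: "\<And>x y. x \<in> set u \<Longrightarrow> y \<in> set v \<Longrightarrow> x < y"
    using assms by (auto simp: direct_def)
  have "inverse_descents (u @ v) = inverse_descents u \<union> inverse_descents v"
  proof (rule set_eqI, clarify)
    fix y x
    have 1: False if "(y, x) \<in> inverse_descents (u @ v)" "y \<in> set u" "x \<in> set v"
      using that less[of y x] by (simp add: inverse_descents_def)
    have 2: "(y, x) \<in> inverse_descents (u @ v) \<longleftrightarrow> (y, x) \<in> inverse_descents u"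
      if "subseq [y, x] u"
    proof (rule mem_inverse_descents_cong[OF _ that])
      show "\<forall>z\<in>set (u @ v) - set u. z \<le> x \<or> y \<le> z"
        using less subseq_pair_set[OF that] by (auto intro!: less_imp_le)
    qed (simp_all add: subseq_pair_append that)
    have 3: "(y, x) \<in> inverse_descents (u @ v) \<longleftrightarrow> (y, x) \<in> inverse_descents v"
      if "subseq [y, x] v"
    proof (rule mem_inverse_descents_cong[OF _ that])
      show "\<forall>z\<in>set (u @ v) - set v. z \<le> x \<or> y \<le> z"
        using less subseq_pair_set[OF that] by (auto intro!: less_imp_le)
    qed (simp_all add: subseq_pair_append that)
    have 4: "subseq [y, x] w" if "(y, x) \<in> inverse_descents w" for w
      using that by (simp add: inverse_descents_def)
    show "(y, x) \<in> inverse_descents (u @ v) \<longleftrightarrow>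
        (y, x) \<in> inverse_descents u \<union> inverse_descents v"
      using 1 2 3 4[of "u @ v"] 4[of u] 4[of v] subseq_pair_append[of y x u v] by blast
  qed
  moreover have "set u \<inter> set v = {}"
    using assms by (auto simp: direct_def)
  ultimately show ?thesis
    by (simp add: card_Un_disjoint finite_inverse_descents inverse_descents_disjoint)
qed

text \<open>Exactly one inverse descent crosses the boundary: the least letter of \<open>u\<close>
  and the greatest letter of \<open>v\<close>, which are neighbours in value.\<close>

lemma card_inverse_descents_skew_sum:
  assumes "direct v u" "u \<noteq> []" "v \<noteq> []"
  shows "card (inverse_descents (u @ v)) =
    card (inverse_descents u) + card (inverse_descents v) + 1"
proof -
  let ?p = "(Min (set u), Max (set v))"
  have *: "set u \<noteq> {}" "set v \<noteq> {}" "\<And>x y. x \<in> set v \<Longrightarrow> y \<in> set u \<Longrightarrow> x < y"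
    using assms by (auto simp: direct_def)
  then have mem: "Min (set u) \<in> set u" "Max (set v) \<in> set v"
    by simp_all
  have disj: "set u \<inter> set v = {}"
    using *(3) by fastforce
  have "inverse_descents (u @ v) = insert ?p (inverse_descents u \<union> inverse_descents v)"
  proof (rule set_eqI, clarify)
    fix y x
    have 1: "(y, x) = ?p" if "(y, x) \<in> inverse_descents (u @ v)" "y \<in> set u" "x \<in> set v"
    proof -
      have "\<forall>z\<in>set u \<union> set v. z \<le> x \<or> y \<le> z"
        using that(1) by (simp add: inverse_descents_def)
      then have "\<forall>z\<in>set u. y \<le> z" "\<forall>z\<in>set v. z \<le> x"
        using that(2,3) *(3) by (metis UnI1 leD, metis UnI2 leD)
      then show ?thesis
        using that Min_eqI[of "set u" y] Max_eqI[of "set v" x] by auto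
    qed
    have 2: "?p \<in> inverse_descents (u @ v)"
      using mem *(3) by (auto simp: inverse_descents_def subseq_pair_append)
    have 3: "(y, x) \<in> inverse_descents (u @ v) \<longleftrightarrow> (y, x) \<in> inverse_descents u"
      if "subseq [y, x] u"
    proof (rule mem_inverse_descents_cong[OF _ that])
      show "\<forall>z\<in>set (u @ v) - set u. z \<le> x \<or> y \<le> z"
        using *(3) subseq_pair_set[OF that] by (auto intro!: less_imp_le)
    qed (simp_all add: subseq_pair_append that)
    have 4: "(y, x) \<in> inverse_descents (u @ v) \<longleftrightarrow> (y, x) \<in> inverse_descents v"
      if "subseq [y, x] v"
    proof (rule mem_inverse_descents_cong[OF _ that])
      show "\<forall>z\<in>set (u @ v) - set v. z \<le> x \<or> y \<le> z"
        using *(3) subseq_pair_set[OF that] by (auto intro!: less_imp_le)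
    qed (simp_all add: subseq_pair_append that)
    have 5: "subseq [y, x] w" if "(y, x) \<in> inverse_descents w" for w
      using that by (simp add: inverse_descents_def)
    show "(y, x) \<in> inverse_descents (u @ v) \<longleftrightarrow>
        (y, x) \<in> insert ?p (inverse_descents u \<union> inverse_descents v)"
      using 1 2 3 4 5[of "u @ v"] 5[of u] 5[of v] subseq_pair_append[of y x u v] by blast
  qed
  moreover have "?p \<notin> inverse_descents u \<union> inverse_descents v"
    using mem disj by (auto simp: inverse_descents_def dest!: subseq_pair_set)
  ultimately show ?thesis
    using inverse_descents_disjoint[OF disj]
    by (simp add: card_Un_disjoint finite_inverse_descents)
qed

lemma subseq_nth_pair:
  assumes "distinct w" "i < length w" "j < length w"
  shows "subseq [w ! i, w ! j] w \<longleftrightarrow> i < j"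
  using assms
proof (induction w arbitrary: i j)
  case (Cons x w)
  then show ?case
    by (cases i; cases j) (auto simp: subseq_singleton_left dest: subseq_pair_set)
qed simp

text \<open>When the letters are \<open>{1..n}\<close>, an empty gap means \<open>y = x + 1\<close>,
  and \<open>x + 1\<close> standing before \<open>x\<close> is a descent of the inverse permutation
  at \<open>x\<close>.\<close>

lemma ides_conv_inverse_descents:
  assumes "\<pi> \<in> Sn n"
  shows "ides \<pi> = card (inverse_descents \<pi>)"
proof -
  have set: "set \<pi> = {1..n}" and dist: "distinct \<pi>"
    using assms by (auto simp: Sn_def permutations_of_set_def)
  have len: "length \<pi> = n"
    using distinct_card[OF dist] set by simp
  define pos where "pos = inv_into {1..n} (letter \<pi>)"
  have img: "letter \<pi> ` {1..n} = {1..n}"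
  proof -
    have "letter \<pi> ` {1..n} = (!) \<pi> ` {0..<n}"
      unfolding letter_def
      by (force simp: image_iff intro: bexI[of _ "Suc _"])
    also have "\<dots> = set \<pi>"
      using len by (metis list.set_map map_nth set_upt)
    finally show ?thesis using set by simp
  qed
  have pos: "pos k \<in> {1..n}" "letter \<pi> (pos k) = k" if "k \<in> {1..n}" for k
    using that img by (metis inv_into_into pos_def, metis f_inv_into_f pos_def)
  have inj: "inj_on (letter \<pi>) {1..n}"
    using img by (simp add: eq_card_imp_inj_on)
  have sub: "subseq [a, b] \<pi> \<longleftrightarrow> pos a < pos b" if "a \<in> {1..n}" "b \<in> {1..n}" for a b
  proof -
    have "pos a - 1 < length \<pi>" "pos b - 1 < length \<pi>" "1 \<le> pos a"
      using pos(1)[OF that(1)] pos(1)[OF that(2)] len by auto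
    then show ?thesis
      using subseq_nth_pair[OF dist, of "pos a - 1" "pos b - 1"] pos(2)[OF that(1)] pos(2)[OF that(2)]
      by (auto simp: letter_def)
  qed
  have inv: "letter (inverse_perm \<pi>) k = pos k" if "k \<in> {1..n}" for k
    using that by (auto simp: inverse_perm_def letter_def len pos_def simp del: upt_Suc)
  have "descent_set (inverse_perm \<pi>) = {k \<in> {1..<n}. pos (k + 1) < pos k}"
    using inv by (auto simp: descent_set_def inverse_perm_def len)
  moreover have "inverse_descents \<pi> = (\<lambda>k. (k + 1, k)) ` {k \<in> {1..<n}. pos (k + 1) < pos k}"
    (is "_ = ?R")
  proof (rule set_eqI, clarify)
    fix y x
    show "(y, x) \<in> inverse_descents \<pi> \<longleftrightarrow> (y, x) \<in> ?R"
    proof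
      assume *: "(y, x) \<in> inverse_descents \<pi>"
      then have mem: "x \<in> {1..n}" "y \<in> {1..n}" and "x < y"
        and gap: "\<forall>z\<in>{1..n}. z \<le> x \<or> y \<le> z"
        using set by (auto simp: inverse_descents_def dest!: subseq_pair_set)
      \<comment> \<open>The value \<open>x + 1\<close> is a letter because \<open>x < y\<close> and
        \<open>y \<le> n\<close>; the gap condition at this letter gives
        \<open>y \<le> x + 1\<close>.\<close>
      then have "y = x + 1"
        using bspec[OF gap, of "x + 1"] by auto
      then show "(y, x) \<in> ?R"
        using * mem sub by (auto simp: inverse_descents_def)
    next
      assume "(y, x) \<in> ?R"
      then show "(y, x) \<in> inverse_descents \<pi>"
        by (auto simp: inverse_descents_def sub)
    qed
  qed
  ultimately show ?thesis
    by (simp add: ides_def des_def card_image inj_on_def)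
qed

section \<open>The recursion of \<open>phi\<close> on words avoiding 213\<close>

text \<open>Keeps from the recursion of \<open>phi\<close> only the sizes and the relative order of
  the target sets, which is all that the statistics depend on.\<close>

lemma phi_decomp:
  fixes s :: "'a::linorder" and T :: "'b::linorder set"
  assumes "finite T" "card T = length (u @ s # v)"
    and "\<forall>x\<in>set u. s < x" "\<forall>x\<in>set v. s < x"
  obtains T1 T2 t where "phi (u @ s # v) T = phi v T1 @ t # phi u T2"
    and "finite T1" "card T1 = length v" "finite T2" "card T2 = length u"
    and "\<forall>a\<in>T1. \<forall>b\<in>T2. a < b" "\<forall>a\<in>T1 \<union> T2. a < t"
proof -
  define ts where "ts = sorted_list_of_set T"
  define m where "m = length (u @ s # v)"
  \<comment> \<open>With \<open>i = length u + 1\<close> the bound \<open>m - i\<close> in the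
    definition of \<open>phi\<close> is \<open>length v\<close>.\<close>
  define T1 where "T1 = letter ts ` {1..length v}"
  define T2 where "T2 = letter ts ` {length v + 1..m - 1}"
  have ts: "length ts = m" "sorted_wrt (<) ts"
    using assms by (simp_all add: ts_def m_def)
  have mono: "letter ts j < letter ts k" if "1 \<le> j" "j < k" "k \<le> m" for j k
    using that ts sorted_wrt_nth_less[OF ts(2), of "j - 1" "k - 1"] by (simp add: letter_def)
  have inj: "inj_on (letter ts) {1..m}"
    by (rule linorder_inj_onI) (use mono in \<open>fastforce+\<close>)
  obtain x xs where w: "u @ s # v = x # xs"
    by (cases "u @ s # v") auto
  have min: "Min (set (u @ s # v)) = s"
    using assms by (intro Min_eqI) (auto intro: less_imp_le)
  have ns: "\<forall>y\<in>set u. y \<noteq> s"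
    using assms by auto
  have parts: "takeWhile (\<lambda>y. y \<noteq> s) (u @ s # v) = u"
    "tl (dropWhile (\<lambda>y. y \<noteq> s) (u @ s # v)) = v"
    using ns by (simp_all add: takeWhile_append dropWhile_append)
  have "phi (u @ s # v) T = phi v T1 @ letter ts m # phi u T2"
    unfolding w phi.simps Let_def unfolding w[symmetric] min parts
    by (simp add: T1_def T2_def m_def ts_def)
  moreover have "finite T1" "finite T2"
    by (simp_all add: T1_def T2_def)
  moreover have "card T1 = length v" "card T2 = length u"
    unfolding T1_def T2_def
    by (subst card_image; auto simp: m_def intro: inj_on_subset[OF inj])+
  moreover have "\<forall>a\<in>T1. \<forall>b\<in>T2. a < b" "\<forall>a\<in>T1 \<union> T2. a < letter ts m"
    by (auto simp: T1_def T2_def m_def intro!: mono)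
  ultimately show ?thesis
    using that by blast
qed

lemma avoids_213_appendD:
  assumes "\<not> contains_pattern (u @ v) [2, 1, 3]"
  shows "\<not> contains_pattern u [2, 1, 3]" "\<not> contains_pattern v [2, 1, 3]"
  using assms unfolding contains_213_iff subseq_triple_append by blast+

text \<open>A letter before the minimum \<open>s\<close> and a greater letter after it would form a
  213 with \<open>s\<close> in the middle.\<close>

lemma split_at_Min_avoiding_213:
  fixes w :: "nat list"
  assumes "w \<noteq> []" "distinct w" "\<not> contains_pattern w [2, 1, 3]"
  obtains u s v where "w = u @ s # v" "\<forall>x\<in>set u. s < x" "\<forall>x\<in>set v. s < x" "direct v u"
proof -
  define s where "s = Min (set w)"
  have "s \<in> set w"
    using assms by (simp add: s_def)
  then obtain u v where w: "w = u @ s # v"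
    by (meson split_list)
  have "s < x" if "x \<in> set u \<union> set v" for x
  proof -
    have "s \<le> x"
      unfolding s_def using that w by (intro Min_le) auto
    then show ?thesis using that w assms(2) by (auto simp: order_less_le)
  qed
  then have less: "\<forall>x\<in>set u. s < x" "\<forall>x\<in>set v. s < x"
    by auto
  have "y < x" if "y \<in> set v" "x \<in> set u" for x y
  proof -
    have "subseq [x, s, y] w"
      using that unfolding w subseq_triple_append by (simp add: subseq_singleton_left)
    then have "\<not> x < y"
      using assms(3) less that unfolding contains_213_iff by blast
    moreover have "x \<noteq> y"
      using that w assms(2) by auto
    ultimately show ?thesis by simp
  qed
  then have "direct v u"
    by (simp add: direct_def)
  with w less show ?thesis
    using that by blast
qed

text \<open>\<open>des\<close> belongs to the same induction because it occurs in the sum formulas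
  for \<open>maj\<close> and \<open>occ\<close>. The set \<open>T\<close> varies, since the two
  parts of \<open>w\<close> are sent to new target sets.\<close>

lemma phi_statistics:
  assumes "distinct w" "\<not> contains_pattern w [2, 1, 3]" "finite T" "card T = length w"
  shows "des (phi w T) = des w \<and> card (inverse_descents (phi w T)) = card (inverse_descents w) \<and>
    maj (phi w T) = occ w + below_hd w \<and> occ (phi w T) + below_hd (phi w T) = maj w"
  using assms
proof (induction "length w" arbitrary: w T rule: less_induct)
  case less
  show ?case
  proof (cases "w = []")
    case False
    then obtain u s v where w: "w = u @ s # v" and s: "\<forall>x\<in>set u. s < x" "\<forall>x\<in>set v. s < x"
      and vu: "direct v u"
      using split_at_Min_avoiding_213[OF False less.prems(1,2)] by blast
    obtain T1 T2 t where phi': "phi (u @ s # v) T = phi v T1 @ t # phi u T2"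
      and T: "finite T1" "card T1 = length v" "finite T2" "card T2 = length u"
      and ord: "\<forall>a\<in>T1. \<forall>b\<in>T2. a < b" "\<forall>a\<in>T1 \<union> T2. a < t"
      by (rule phi_decomp[OF less.prems(3) less.prems(4)[unfolded w] s])
    note phi = phi'[folded w]
    have av: "\<not> contains_pattern u [2, 1, 3]" "\<not> contains_pattern v [2, 1, 3]"
      using less.prems(2) avoids_213_appendD[of u "s # v"] avoids_213_appendD[of "u @ [s]" v]
      unfolding w by auto
    have "length u < length w" "distinct u" "length v < length w" "distinct v"
      using less.prems(1) by (simp_all add: w)
    note IH = less.hyps[OF this(1,2) av(1) T(3,4)] less.hyps[OF this(3,4) av(2) T(1,2)]
    define A where "A = phi v T1"
    define B where "B = phi u T2"
    have len: "set A = T1" "length A = length v" "set B = T2" "length B = length u"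
      using phi_word[OF T(1,2)] phi_word[OF T(3,4)] by (auto simp: A_def B_def)
    have Anil: "A = [] \<longleftrightarrow> v = []" "v = [] \<Longrightarrow> below_hd A = 0" and Bnil: "B = [] \<longleftrightarrow> u = []"
      using len by auto
    have dv: "direct [s] v" and du: "direct ([s] @ v) u"
      using s vu by auto
    have dB: "direct B [t]" and dA: "direct A ([t] @ B)"
      using ord len by (auto simp: direct_def)
    \<comment> \<open>In \<open>w\<close> the extra inverse descent comes from \<open>u\<close>
      above \<open>s # v\<close>, in the image from \<open>t\<close> above \<open>B\<close>. Both
      exist exactly when \<open>u\<close> is nonempty.\<close>
    have iw: "card (inverse_descents w) =
        card (inverse_descents u) + card (inverse_descents v) + of_bool (u \<noteq> [])"
      using card_inverse_descents_skew_sum[OF du] card_inverse_descents_direct_sum[OF dv] w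
      by (cases "u = []") auto
    have ip: "card (inverse_descents (phi w T)) =
        card (inverse_descents A) + card (inverse_descents B) + of_bool (u \<noteq> [])"
      using card_inverse_descents_skew_sum[OF dB] card_inverse_descents_direct_sum[OF dA] Bnil
      by (cases "u = []") (auto simp: phi A_def B_def)
    note sums = des_skew_sum[OF du] des_direct_sum[OF dv] des_skew_sum[OF dB] des_direct_sum[OF dA]
      maj_skew_sum[OF du] maj_direct_sum[OF dv] maj_skew_sum[OF dB] maj_direct_sum[OF dA]
      occ_skew_sum[OF du] occ_direct_sum[OF dv] occ_skew_sum[OF dB] occ_direct_sum[OF dA]
      below_hd_skew_sum[OF du] below_hd_direct_sum[OF dv] below_hd_skew_sum[OF dB]
      below_hd_direct_sum[OF dA]
    have weq: "w = u @ [s] @ v"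
      by (simp add: w)
    have peq: "phi w T = A @ [t] @ B"
      by (simp add: phi A_def B_def)
    have IH': "des B = des u" "card (inverse_descents B) = card (inverse_descents u)"
      "maj B = occ u + below_hd u" "maj u = occ B + below_hd B"
      "des A = des v" "card (inverse_descents A) = card (inverse_descents v)"
      "maj A = occ v + below_hd v" "maj v = occ A + below_hd A"
      using IH by (simp_all add: A_def B_def)
    show ?thesis
      unfolding iw ip unfolding peq unfolding weq sums IH' len Bnil Anil(1)
      \<comment> \<open>The summand \<open>length u\<close> of \<open>maj w\<close> comes from the
        descent into \<open>s\<close>. In the image it is the boundary term between \<open>A\<close>
        and \<open>t\<close> if \<open>v\<close> is nonempty, and \<open>below_hd\<close> of
        \<open>t # B\<close> otherwise.\<close>
      by (cases "v = []") (auto simp: IH' len Anil Bnil algebra_simps)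
  qed simp
qed

section \<open>From \<open>phi\<close> on the two blocks to \<open>alpha\<close>\<close>

theorem lemma2p8:
  fixes n :: nat and \<pi> :: "nat list"
  assumes "1 \<le> n" and "\<pi> \<in> Sn_avoiding n [2, 1, 3]"
  shows "des \<pi> = des (alpha \<pi>) \<and> ides \<pi> = ides (alpha \<pi>) \<and>
    maj \<pi> = stat (alpha \<pi>) \<and> stat \<pi> = maj (alpha \<pi>)"
proof -
  have Sn: "\<pi> \<in> Sn n" "alpha \<pi> \<in> Sn n" and av: "\<not> contains_pattern \<pi> [2, 1, 3]"
    using assms alpha_in_Sn_avoiding_231[OF assms] by (auto simp: Sn_avoiding_def)
  obtain k w where \<pi>: "\<pi> = k # w"
    using assms Sn by (cases \<pi>) (auto simp: Sn_def permutations_of_set_def)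
  note d = avoiding_213_decomp[OF assms(2)[unfolded \<pi>]]
  define p where "p = take (n - k) w"
  define q where "q = drop (n - k) w"
  define A where "A = phi q {1..k - 1}"
  define B where "B = phi p {k + 1..n}"
  have w: "w = p @ q"
    by (simp add: p_def q_def)
  have pq: "set p = {k + 1..n}" "set q = {1..k - 1}" "distinct p" "distinct q"
    using d(4,5) by (auto simp: p_def q_def permutations_of_set_def)
  have l: "length p = n - k" "length q = k - 1"
    using d(1-3) by (auto simp: p_def q_def)
  have avs: "\<not> contains_pattern p [2, 1, 3]" "\<not> contains_pattern q [2, 1, 3]"
    using av avoids_213_appendD[of "[k] @ p" q] avoids_213_appendD[of "[k]" p]
    unfolding \<pi> w by auto
  have A: "set A = {1..k - 1}" "length A = length q"
    using phi_word[of "{1..k - 1}" q] l by (auto simp: A_def)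
  have B: "set B = {k + 1..n}" "length B = length p"
    using phi_word[of "{k + 1..n}" p] l by (auto simp: B_def)
  have nil: "A = [] \<longleftrightarrow> q = []" "B = [] \<longleftrightarrow> p = []"
    using A(2) B(2) by auto
  have statA: "des A = des q" "card (inverse_descents A) = card (inverse_descents q)"
    "maj A = occ q + below_hd q" "maj q = occ A + below_hd A"
    using phi_statistics[OF pq(4) avs(2), of "{1..k - 1}"] l by (simp_all add: A_def)
  have statB: "des B = des p" "card (inverse_descents B) = card (inverse_descents p)"
    "maj B = occ p + below_hd p" "maj p = occ B + below_hd B"
    using phi_statistics[OF pq(3) avs(1), of "{k + 1..n}"] l by (simp_all add: B_def)
  \<comment> \<open>In \<open>\<pi>\<close> the inner sum is direct and the outer one skew; in
    \<open>alpha \<pi>\<close> it is the other way round, and the blocks change places.\<close>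
  have eq: "\<pi> = ([k] @ p) @ q" "alpha \<pi> = ([k] @ A) @ B"
    using d(1) by (simp_all add: \<pi> A_def B_def Let_def p_def q_def)
  have d1: "direct [k] p" and d2: "direct q ([k] @ p)"
    and d3: "direct A [k]" and d4: "direct ([k] @ A) B"
    using pq(1,2) A(1) B(1) d(2) by (auto simp: direct_def)
  note sums = des_skew_sum[OF d2] des_direct_sum[OF d1] des_skew_sum[OF d3] des_direct_sum[OF d4]
      maj_skew_sum[OF d2] maj_direct_sum[OF d1] maj_skew_sum[OF d3] maj_direct_sum[OF d4]
      occ_skew_sum[OF d2] occ_direct_sum[OF d1] occ_skew_sum[OF d3] occ_direct_sum[OF d4]
  \<comment> \<open>Both words gain one inverse descent, formed by \<open>k\<close> and
    \<open>k - 1\<close>, exactly when \<open>q\<close> is nonempty.\<close>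
  have "card (inverse_descents \<pi>) = card (inverse_descents (alpha \<pi>))"
    using card_inverse_descents_direct_sum[OF d1] card_inverse_descents_skew_sum[OF d2]
      card_inverse_descents_skew_sum[OF d3] card_inverse_descents_direct_sum[OF d4]
    unfolding eq(2) unfolding eq(1) by (cases "q = []") (use nil statA statB in auto)
  then have "ides \<pi> = ides (alpha \<pi>)"
    using Sn by (simp add: ides_conv_inverse_descents)
  \<comment> \<open>Each block follows a nonempty prefix, so \<open>occ\<close> gains
    \<open>below_hd\<close> of that block. This completes \<open>occ\<close> of \<open>A\<close> and
    \<open>B\<close> to \<open>maj\<close> of \<open>q\<close> and \<open>p\<close>, and
    \<open>occ\<close> of \<open>p\<close> and \<open>q\<close> to \<open>maj\<close> of
    \<open>B\<close> and \<open>A\<close>.\<close>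
  moreover have "des \<pi> = des (alpha \<pi>) \<and> maj \<pi> = stat (alpha \<pi>) \<and> stat \<pi> = maj (alpha \<pi>)"
    unfolding stat_conv_occ eq(2) unfolding eq(1) sums
    by (auto simp: statA statB nil A B algebra_simps)
  ultimately show ?thesis
    by blast
qed

end
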